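(* For any $\mathbf m\in\Sigma^*$, we have $\nu(\xi_{\mathbf m})=\mu(G_{\mathbf m})/3=1/3$, where $G_{\mathbf m}(U,T)=(T-\xi_{\mathbf m}U)(T-(\xi_{\mathbf m}+3)U)$.
   Context: The Lagrange constant of $\xi\in\mathbb R$ is $\nu(\xi)=\liminf_{q\to\infty}q\|q\xi\|$, where $\|x\|$ is the distance from $x$ to a closest integer. For a real binary quadratic form $F(U,T)$, $\mu(F)=\inf\{|F(x,y)|\,;\,(x,y)\in\mathbb Z^2,\ (x,y)\ne(0,0)\}$. Markoff tree: $\Sigma^*$ is the set of nodes of the following tree of ordered triples of positive integers, all of which are solutions of $m^2+m_1^2+m_2^2=3mm_1m_2$. The root is $(2,1,1)$; it has a single successor, $(5,1,2)$, which is a left successor. Every other node $(m,m_1,m_2)$ has a left successor $(3mm_1-m_2,m_1,m)$ and a right successor $(3mm_2-m_1,m,m_2)$. A \emph{zigzag} is an infinite sequence of nodes $\mathbf m^{(1)},\mathbf m^{(2)},\dots$ such that, for each $i\ge1$, $\mathbf m^{(i+1)}$ is a successor of $\mathbf m^{(i)}$ on some side (left or right) and $\mathbf m^{(i+2)}$ is a successor of $\mathbf m^{(i+1)}$ on the other side. It is \emph{maximal} if it cannot be extended to a zigzag by inserting the ancestor of $\mathbf m^{(1)}$ (the node of which it is a successor) as first element. Each $\mathbf m\in\Sigma^*$ is the first element of a unique maximal zigzag. Matrices: put $M=\begin{pmatrix}3&1\\-1&0\end{pmatrix}$ and consider the binary tree of triples of matrices with root $\left(\begin{pmatrix}5&3\\3&2\end{pmatrix},\begin{pmatrix}1&1\\1&2\end{pmatrix},\begin{pmatrix}2&1\\1&1\end{pmatrix}\right)$,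 where each node $(\mathbf x,\mathbf x_1,\mathbf x_2)$ has left successor $(\mathbf x_1M\mathbf x,\mathbf x_1,\mathbf x)$ and right successor $(\mathbf xM\mathbf x_2,\mathbf x,\mathbf x_2)$. For $\mathbf m\in\Sigma^*$, $\mathbf m\ne(2,1,1)$, let $\mathbf x_{\mathbf m}$ be the first component of the node of this matrix tree occupying the same position as $\mathbf m$ in the subtree of the Markoff tree rooted at $(5,1,2)$; put $\mathbf x_{(2,1,1)}=\begin{pmatrix}2&1\\1&1\end{pmatrix}$. For $\mathbf m=(m,m_1,m_2)$, the matrix $\mathbf x_{\mathbf m}=\begin{pmatrix}m&k\\k&\ell\end{pmatrix}$ is symmetric in $\mathrm{SL}_2(\mathbb Z)$ with upper left entry $m$, and one sets $\alpha_{\mathbf m}=\frac{2k-3m+\sqrt{9m^2-4}}{2m}$. For $\mathbf m\in\Sigma^*$, with maximal zigzag $\mathbf m=\mathbf m^{(1)},\mathbf m^{(2)},\dots$ originating from $\mathbf m$, one defines $\xi_{\mathbf m}=\lim_{i\to\infty}\alpha_{\mathbf m^{(i)}}$ (this limit exists). *)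

theory Defs
  imports "HOL-Analysis.Analysis"
begin

definition int_dist :: "real \<Rightarrow> real" where
  "int_dist x = dist x (of_int (round x))"

text \<open>The lower limit is taken in the extended reals, which form a complete lattice.\<close>
definition lagrange_const :: "real \<Rightarrow> ereal" where
  "lagrange_const \<xi> = liminf (\<lambda>q::nat. ereal (real q * int_dist (real q * \<xi>)))"

text \<open>A binary form is given by the function that it induces on pairs of reals.\<close>
definition form_min :: "(real \<Rightarrow> real \<Rightarrow> real) \<Rightarrow> real" where
  "form_min F = Inf {\<bar>F (of_int x) (of_int y)\<bar> | x y :: int. (x, y) \<noteq> (0, 0)}"

type_synonym triple = "int \<times> int \<times> int"

datatype side = Left | Right

fun other_side :: "side \<Rightarrow> side" where
  "other_side Left = Right"
| "other_side Right = Left"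

fun markoff_child :: "side \<Rightarrow> triple \<Rightarrow> triple" where
  "markoff_child Left (m, m1, m2) = (3 * m * m1 - m2, m1, m)"
| "markoff_child Right (m, m1, m2) = (3 * m * m2 - m1, m, m2)"

definition markoff_succ :: "side \<Rightarrow> triple \<Rightarrow> triple \<Rightarrow> bool" where
  "markoff_succ s p n \<longleftrightarrow> n = markoff_child s p \<and> (p = (2, 1, 1) \<longrightarrow> s = Left)"

inductive_set Sigma_star :: "triple set" where
  root: "(2, 1, 1) \<in> Sigma_star"
| succ: "p \<in> Sigma_star \<Longrightarrow> markoff_succ s p n \<Longrightarrow> n \<in> Sigma_star"

text \<open>Sequences are indexed from 0, so that \<open>z i\<close> is the node of index \<open>i + 1\<close> of the zigzag.\<close>
definition zigzag :: "(nat \<Rightarrow> triple) \<Rightarrow> bool" where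
  "zigzag z \<longleftrightarrow> (\<forall>i. z i \<in> Sigma_star) \<and>
     (\<forall>i. \<exists>s. markoff_succ s (z i) (z (Suc i)) \<and>
              markoff_succ (other_side s) (z (Suc i)) (z (Suc (Suc i))))"

text \<open>Here \<open>case_nat a z\<close> is the sequence \<open>a, z 0, z 1, \<dots>\<close>; if it is a zigzag,
  then \<open>a\<close> is the ancestor of \<open>z 0\<close>.\<close>
definition maximal_zigzag :: "(nat \<Rightarrow> triple) \<Rightarrow> bool" where
  "maximal_zigzag z \<longleftrightarrow> zigzag z \<and> \<not> (\<exists>a. zigzag (case_nat a z))"

definition zigzag_from :: "triple \<Rightarrow> nat \<Rightarrow> triple" where
  "zigzag_from \<mm> = (THE z. maximal_zigzag z \<and> z 0 = \<mm>)"

type_synonym mat2 = "int^2^2"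

definition M_mat :: mat2 where
  "M_mat = vector [vector [3, 1], vector [-1, 0]]"

definition matrix_root :: "mat2 \<times> mat2 \<times> mat2" where
  "matrix_root = (vector [vector [5, 3], vector [3, 2]],
                  vector [vector [1, 1], vector [1, 2]],
                  vector [vector [2, 1], vector [1, 1]])"

fun matrix_child :: "side \<Rightarrow> mat2 \<times> mat2 \<times> mat2 \<Rightarrow> mat2 \<times> mat2 \<times> mat2" where
  "matrix_child Left (x, x1, x2) = (x1 ** M_mat ** x, x1, x)"
| "matrix_child Right (x, x1, x2) = (x ** M_mat ** x2, x, x2)"

text \<open>The position of a node below \<open>(5, 1, 2)\<close> is the list of sides taken on the way down
  from \<open>(5, 1, 2)\<close>, first step first.\<close>
definition position :: "triple \<Rightarrow> side list" where
  "position \<mm> = (THE w. fold markoff_child w (5, 1, 2) = \<mm>)"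

definition x_mat :: "triple \<Rightarrow> mat2" where
  "x_mat \<mm> = (if \<mm> = (2, 1, 1) then vector [vector [2, 1], vector [1, 1]]
              else fst (fold matrix_child (position \<mm>) matrix_root))"

definition alpha :: "triple \<Rightarrow> real" where
  "alpha \<mm> = (let m = real_of_int (fst \<mm>); k = real_of_int (x_mat \<mm> $ 1 $ 2)
              in (2 * k - 3 * m + sqrt (9 * m\<^sup>2 - 4)) / (2 * m))"

definition xi :: "triple \<Rightarrow> real" where
  "xi \<mm> = lim (\<lambda>i. alpha (zigzag_from \<mm> i))"

definition G_form :: "triple \<Rightarrow> real \<Rightarrow> real \<Rightarrow> real" where
  "G_form \<mm> U T = (T - xi \<mm> * U) * (T - (xi \<mm> + 3) * U)"

end

theory Submission
  imports Defs
begin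

text \<open>
  For a node \<open>\<mm> = (m, m\<^sub>1, m\<^sub>2)\<close> put \<open>p = k / m\<close>, where \<open>k\<close> is the off-diagonal entry of
  the matrix attached to \<open>\<mm>\<close>. With \<open>s = m T - k U\<close> and \<open>t = U\<close>, the
  Markoff form of \<open>\<mm>\<close>, with the coefficient of \<open>T\<^sup>2\<close> normalised to 1,
  \<open>(T - p U)\<^sup>2 + 3 (T - p U) U + U\<^sup>2 / m\<^sup>2\<close> becomes
  \<open>(s\<^sup>2 + t\<^sup>2 + 3 m s t) / m\<^sup>2\<close>, and the integer pairs \<open>(U, T)\<close> correspond to the pairs \<open>(s, t)\<close> with \<open>m\<close> dividing
  \<open>s m\<^sub>1 - t m\<^sub>2\<close>, since \<open>m\<close> divides \<open>k m\<^sub>1 + m\<^sub>2\<close> (\<open>numer_dvd\<close>).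

  The heart of the proof is \<open>mform_bound\<close>: on the non-zero pairs of this lattice,
  \<open>\<bar>s\<^sup>2 + t\<^sup>2 + 3 m s t\<bar> \<ge> m\<^sup>2\<close>. For \<open>s, t \<ge> 0\<close> this is shown by induction along the tree:
  the lattice point \<open>(m\<^sub>2, m\<^sub>1)\<close> splits the quadrant into two cones, and in coordinates adapted to
  either cone the form dominates the corresponding form for \<open>m\<^sub>1\<close> or \<open>m\<^sub>2\<close>
  (\<open>quadrant_bound_half\<close>, \<open>good_triple_vieta\<close>). Other pairs of non-negative value are brought
  into that quadrant, up to sign, by powers of the automorph \<open>(s, t) \<mapsto> (- t, s + 3 m t)\<close> of the form
  (\<open>mform_descent\<close>), and the pairs of negative value are exchanged with those of positive value by
  a linear substitution that changes the sign of the form.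

  Along a zigzag the ratios \<open>p\<^sub>i = k\<^sub>i / m\<^sub>i\<close> have alternating differences of absolute value
  \<open>d\<^sub>i = m\<^sub>i\<^sub>-\<^sub>1 / (m\<^sub>i m\<^sub>i\<^sub>+\<^sub>1)\<close>, where \<open>m\<^sub>i\<^sub>+\<^sub>1 = 3 m\<^sub>i m\<^sub>i\<^sub>-\<^sub>1 - c\<close> with
  \<open>0 < c < m\<^sub>i\<^sub>-\<^sub>1\<close>, for all \<open>i\<close> but the first. Hence they converge to \<open>\<xi>\<^sub>\<mm>\<close>, with
  \<open>m\<^sub>i\<^sup>2 \<bar>p\<^sub>i - \<xi>\<^sub>\<mm>\<bar> \<le> m\<^sub>i\<^sup>2 d\<^sub>i\<close>, and the right-hand side tends to \<open>1/3\<close>. This gives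
  \<open>\<nu>(\<xi>\<^sub>\<mm>) \<le> 1/3\<close>. The normalised Markoff forms of the nodes converge to
  \<open>(T - \<xi>\<^sub>\<mm> U) (T - (\<xi>\<^sub>\<mm> - 3) U) = G\<^sub>\<mm>(U, T + 3 U)\<close>, so \<open>\<bar>G\<^sub>\<mm>\<bar> \<ge> 1\<close> at all non-zero
  integer points, with equality at \<open>(0, 1)\<close>. Evaluating at \<open>(q, n)\<close>, with \<open>n\<close> an integer closest to
  \<open>q \<xi>\<^sub>\<mm>\<close>, gives \<open>\<nu>(\<xi>\<^sub>\<mm>) \<ge> 1/3\<close>.
\<close>

section \<open>The quadratic form of a Markoff triple\<close>

text \<open>A solution of Markoff's equation in pairwise coprime positive integers. The order of the
  entries is irrelevant here; the first one is merely singled out as modulus.\<close>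
definition markoff :: "int \<Rightarrow> int \<Rightarrow> int \<Rightarrow> bool" where
  "markoff m x y \<longleftrightarrow> 0 < m \<and> 0 < x \<and> 0 < y \<and> m\<^sup>2 + x\<^sup>2 + y\<^sup>2 = 3 * m * x * y \<and>
     coprime m x \<and> coprime m y \<and> coprime x y"

text \<open>This is \<open>m\<^sup>2\<close> times a normalised Markoff form, in the coordinates \<open>s = m T - k U\<close> and
  \<open>t = U\<close>.\<close>
definition mform :: "int \<Rightarrow> int \<Rightarrow> int \<Rightarrow> int" where
  "mform m s t = s\<^sup>2 + t\<^sup>2 + 3 * m * s * t"

text \<open>The bound on the part of the lattice \<open>{(s, t). m dvd s x - t y}\<close> in the closed first
  quadrant. Interchanging \<open>x\<close> and \<open>y\<close> reflects the lattice in the diagonal.\<close>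
definition quadrant_bound :: "int \<Rightarrow> int \<Rightarrow> int \<Rightarrow> bool" where
  "quadrant_bound m x y \<longleftrightarrow>
     (\<forall>s\<ge>0. \<forall>t\<ge>0. (s, t) \<noteq> (0, 0) \<longrightarrow> m dvd s * x - t * y \<longrightarrow> m\<^sup>2 \<le> mform m s t)"

lemma mform_commute: "mform m s t = mform m t s"
  by (simp add: mform_def algebra_simps)

lemma markoff_swap:
  assumes "markoff m x y"
  shows "markoff m y x" "markoff x m y"
  using assms by (auto simp: markoff_def coprime_commute algebra_simps)

text \<open>Since \<open>m\<close> divides \<open>x\<^sup>2 + y\<^sup>2\<close>, the lattice is invariant under the rotation by a right
  angle.\<close>
lemma dvd_rotate:
  assumes "markoff m x y"
  shows "m dvd s * x - t * y \<longleftrightarrow> m dvd s * y + t * x"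
proof -
  have co: "coprime m x" "coprime m y" and eq: "m\<^sup>2 + x\<^sup>2 + y\<^sup>2 = 3 * m * x * y"
    using assms by (auto simp: markoff_def)
  have "x\<^sup>2 + y\<^sup>2 = m * (3 * x * y - m)"
    using eq by (simp add: algebra_simps power2_eq_square)
  then have d: "m dvd t * (x\<^sup>2 + y\<^sup>2)" by simp
  have "m dvd s * x - t * y \<longleftrightarrow> m dvd y * (s * x - t * y)"
    using co by (simp add: coprime_dvd_mult_right_iff)
  also have "\<dots> \<longleftrightarrow> m dvd y * (s * x - t * y) + t * (x\<^sup>2 + y\<^sup>2)"
    using d by (simp add: dvd_add_left_iff)
  also have "y * (s * x - t * y) + t * (x\<^sup>2 + y\<^sup>2) = x * (s * y + t * x)"
    by (simp add: algebra_simps power2_eq_square)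
  also have "m dvd x * (s * y + t * x) \<longleftrightarrow> m dvd s * y + t * x"
    using co by (simp add: coprime_dvd_mult_right_iff)
  finally show ?thesis .
qed

lemma quadrant_bound_commute:
  assumes "quadrant_bound m x y"
  shows "quadrant_bound m y x"
  unfolding quadrant_bound_def
proof (intro allI impI)
  fix s t :: int
  assume "0 \<le> s" "0 \<le> t" "(s, t) \<noteq> (0, 0)" "m dvd s * y - t * x"
  moreover from this have "m dvd t * x - s * y" by (metis dvd_minus_iff minus_diff_eq)
  ultimately have "m\<^sup>2 \<le> mform m t s"
    using assms unfolding quadrant_bound_def by blast
  then show "m\<^sup>2 \<le> mform m s t" by (simp add: mform_commute)
qed

text \<open>The lattice of the modulus \<open>x\<close> is the same for the two Markoff triples that contain both
  \<open>x\<close> and \<open>y\<close>, up to reflection.\<close>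
lemma quadrant_bound_vieta:
  assumes "markoff m x y" "quadrant_bound x m y"
  shows "quadrant_bound x (3 * x * y - m) y"
  unfolding quadrant_bound_def
proof (intro allI impI)
  fix s t :: int
  assume st: "0 \<le> s" "0 \<le> t" "(s, t) \<noteq> (0, 0)" and d: "x dvd s * (3 * x * y - m) - t * y"
  have "x dvd x * (3 * s * y) - (s * (3 * x * y - m) - t * y)"
    by (rule dvd_diff[OF dvd_triv_left d])
  then have "x dvd t * y + s * m" by (simp add: algebra_simps)
  then have "x dvd t * m - s * y"
    using dvd_rotate[OF markoff_swap(2)[OF assms(1)]] by simp
  then have "x\<^sup>2 \<le> mform x t s"
    using assms(2) st unfolding quadrant_bound_def by blast
  then show "x\<^sup>2 \<le> mform x s t" by (simp add: mform_commute)
qed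

text \<open>The lattice point \<open>(y, x)\<close> divides the quadrant into two cones. A point of the one between
  \<open>(m, 0)\<close> and \<open>(y, x)\<close> is \<open>(a (m, 0) + t (y, x)) / x\<close> for integers \<open>a, t \<ge> 0\<close>, where \<open>(a, t)\<close> lies
  in the lattice of the modulus \<open>x\<close> in the neighbouring triple \<open>(3xy - m, x, y)\<close>.\<close>
lemma quadrant_bound_half:
  assumes "markoff m x y" and b: "quadrant_bound x (3 * x * y - m) y"
    and st: "0 \<le> s" "0 \<le> t" "(s, t) \<noteq> (0, 0)"
    and d: "m dvd s * x - t * y" and le: "t * y \<le> s * x"
  shows "m\<^sup>2 \<le> mform m s t"
proof -
  have pos: "0 < m" "0 < x" "0 < y" and eq: "m\<^sup>2 + x\<^sup>2 + y\<^sup>2 = 3 * m * x * y"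
    using assms(1) by (auto simp: markoff_def)
  obtain a where a: "s * x - t * y = m * a" using d by blast
  have a0: "0 \<le> a" using a le pos by (metis diff_ge_0_iff_ge zero_le_mult_iff linorder_not_less)
  have sx: "s * x = m * a + t * y" using a by simp
  have nz: "(a, t) \<noteq> (0, 0)" using sx st pos by auto
  have "a * (3 * x * y - m) - t * y = x * (3 * a * y) - (m * a + t * y)"
    by (simp add: algebra_simps)
  also have "\<dots> = x * (3 * a * y - s)" unfolding sx[symmetric] by (simp add: algebra_simps)
  finally have "x dvd a * (3 * x * y - m) - t * y" by simp
  then have h: "x\<^sup>2 \<le> mform x a t"
    using b a0 st nz unfolding quadrant_bound_def by blast
  have "x\<^sup>2 * mform m s t
      = (s * x)\<^sup>2 + x\<^sup>2 * t\<^sup>2 + 3 * m * x * t * (s * x)"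
    by (simp add: mform_def algebra_simps power2_eq_square)
  also have "\<dots> = m\<^sup>2 * mform x a t + 2 * m * a * t * y + t\<^sup>2 * (x\<^sup>2 + y\<^sup>2 + 3 * m * x * y - m\<^sup>2)"
    unfolding sx by (simp add: mform_def algebra_simps power2_eq_square)
  also have "x\<^sup>2 + y\<^sup>2 + 3 * m * x * y - m\<^sup>2 = 2 * (x\<^sup>2 + y\<^sup>2)"
    using eq by simp
  finally have "m\<^sup>2 * mform x a t \<le> x\<^sup>2 * mform m s t"
    using pos a0 st by simp
  moreover have "m\<^sup>2 * x\<^sup>2 \<le> m\<^sup>2 * mform x a t"
    using h by (intro mult_left_mono) auto
  ultimately have "x\<^sup>2 * m\<^sup>2 \<le> x\<^sup>2 * mform m s t" by (simp add: mult.commute)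
  then show ?thesis using pos by simp
qed

text \<open>A Markoff triple that satisfies the quadrant bound for each of its three entries as
  modulus.\<close>
definition good_triple :: "int \<Rightarrow> int \<Rightarrow> int \<Rightarrow> bool" where
  "good_triple m x y \<longleftrightarrow> markoff m x y \<and>
     quadrant_bound m x y \<and> quadrant_bound x m y \<and> quadrant_bound y m x"

lemma good_triple_swap:
  assumes "good_triple m x y"
  shows "good_triple m y x" "good_triple x m y"
  using assms markoff_swap quadrant_bound_commute unfolding good_triple_def by blast+

lemma markoff_vieta:
  assumes "markoff m x y"
  shows "markoff (3 * x * y - m) x y"
proof -
  have pos: "0 < m" "0 < x" "0 < y" and eq: "m\<^sup>2 + x\<^sup>2 + y\<^sup>2 = 3 * m * x * y"
    using assms by (auto simp: markoff_def)
  have "m * (3 * x * y - m) = x\<^sup>2 + y\<^sup>2"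
    using eq by (simp add: algebra_simps power2_eq_square)
  then have "0 < m * (3 * x * y - m)" using pos by (simp add: add_pos_pos)
  then have 1: "0 < 3 * x * y - m" using pos by (simp add: zero_less_mult_iff)
  have "coprime (3 * x * y - m) z" if z: "z dvd 3 * x * y" "coprime m z" for z
  proof (rule coprimeI)
    fix c assume c: "c dvd 3 * x * y - m" "c dvd z"
    then have "c dvd 3 * x * y - (3 * x * y - m)" using z by (meson dvd_diff dvd_trans)
    then have "c dvd m" by simp
    then show "is_unit c" using z c coprime_common_divisor by fastforce
  qed
  then have "coprime (3 * x * y - m) x" "coprime (3 * x * y - m) y"
    using assms by (auto simp: markoff_def)
  moreover have "(3 * x * y - m)\<^sup>2 + x\<^sup>2 + y\<^sup>2 = 3 * (3 * x * y - m) * x * y"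
    using eq by algebra
  ultimately show ?thesis using assms 1 unfolding markoff_def by blast
qed

lemma good_triple_vieta:
  assumes "good_triple m x y"
  shows "good_triple (3 * x * y - m) x y"
proof -
  let ?n = "3 * x * y - m"
  have mk: "markoff m x y" and b: "quadrant_bound x m y" "quadrant_bound y m x"
    using assms by (auto simp: good_triple_def)
  note mk' = markoff_vieta[OF mk]
  have "quadrant_bound ?n x y"
    unfolding quadrant_bound_def
  proof (intro allI impI)
    fix s t :: int
    assume st: "0 \<le> s" "0 \<le> t" "(s, t) \<noteq> (0, 0)" and d: "?n dvd s * x - t * y"
    show "?n\<^sup>2 \<le> mform ?n s t"
    proof (cases "t * y \<le> s * x")
      case True
      show ?thesis by (rule quadrant_bound_half[OF mk' _ st d True]) (use b in simp)
    next
      case False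
      have "?n\<^sup>2 \<le> mform ?n t s"
      proof (rule quadrant_bound_half[OF markoff_swap(1)[OF mk']])
        show "quadrant_bound y (3 * y * x - ?n) x" using b by (simp add: algebra_simps)
        show "?n dvd t * y - s * x" using d by (metis dvd_minus_iff minus_diff_eq)
      qed (use st False in auto)
      then show ?thesis by (simp add: mform_commute)
    qed
  qed
  moreover have "quadrant_bound x ?n y" by (rule quadrant_bound_vieta[OF mk b(1)])
  moreover have "quadrant_bound y ?n x"
    using quadrant_bound_vieta[OF markoff_swap(1)[OF mk] b(2)] by (simp add: algebra_simps)
  ultimately show ?thesis using mk' by (simp add: good_triple_def)
qed

text \<open>If \<open>s > r > 0\<close> and the form is non-negative at \<open>(s, - r)\<close>, its automorph
  \<open>(s, - r) \<mapsto> (r, s - 3 m r)\<close> leads either into the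
  first quadrant or to a pair of opposite signs with a smaller sum of absolute values.\<close>
lemma mform_descent:
  assumes "markoff m x y" "quadrant_bound m x y"
    and "0 < s" "0 < r" "m dvd s * x + r * y" "0 \<le> mform m s (- r)"
  shows "m\<^sup>2 \<le> mform m s (- r)"
  using assms
proof (induction "nat (s + r)" arbitrary: s r x y rule: less_induct)
  case less
  have m: "0 < m" using less.prems by (simp add: markoff_def)
  have step: "m\<^sup>2 \<le> mform m a (- b)"
    if ab: "b < a" "a + b = s + r" "0 < a" "0 < b" and mk: "markoff m v w"
      and qb: "quadrant_bound m v w" and d: "m dvd a * v + b * w" and q: "0 \<le> mform m a (- b)"
    for a b v w
  proof -
    let ?c = "a - 3 * m * b"
    have inv: "mform m a (- b) = mform m b ?c"
      by (simp add: mform_def algebra_simps power2_eq_square)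
    have d': "m dvd b * v - a * w"
      using dvd_rotate[OF mk, of b a] d by (simp add: algebra_simps)
    have d2: "m dvd b * v - ?c * w"
    proof -
      have "b * v - ?c * w = (b * v - a * w) + m * (3 * b * w)" by (simp add: algebra_simps)
      then show ?thesis using d' by (metis dvd_add dvd_triv_left)
    qed
    show ?thesis
    proof (cases "0 \<le> ?c")
      case True
      then show ?thesis
        using qb d2 ab unfolding inv quadrant_bound_def by simp
    next
      case False
      have "a * ?c + b * b = mform m a (- b)"
        by (simp add: mform_def algebra_simps power2_eq_square)
      then have "0 \<le> a * ?c + b * b" using q by simp
      also have "\<dots> < a * ?c + a * b" using ab by simp
      also have "\<dots> = a * (?c + b)" by (simp add: algebra_simps)
      finally have "0 < ?c + b" using ab by (simp add: zero_less_mult_iff)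
      then have lt: "nat (b + (- ?c)) < nat (s + r)" using ab by linarith
      have "m dvd b * v + (- ?c) * w"
        using d2 by (simp only: diff_conv_add_uminus mult_minus_left)
      then have "m\<^sup>2 \<le> mform m b (- (- ?c))"
        by (intro less.hyps[OF lt mk qb]) (use ab False q inv in auto)
      then show ?thesis by (simp add: inv)
    qed
  qed
  consider "s < r" | "s = r" | "r < s" by linarith
  then show ?case
  proof cases
    case 1
    have eq: "mform m s (- r) = mform m r (- s)"
      by (simp add: mform_def algebra_simps)
    show ?thesis unfolding eq
      by (rule step[OF _ _ _ _ markoff_swap(1)[OF less.prems(1)]
            quadrant_bound_commute[OF less.prems(2)]])
         (use 1 less.prems eq in \<open>auto simp: add.commute\<close>)
  next
    case 2
    then have "mform m s (- r) = - ((3 * m - 2) * s\<^sup>2)"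
      by (simp add: mform_def algebra_simps power2_eq_square)
    moreover have "0 < (3 * m - 2) * s\<^sup>2" using m less.prems by simp
    ultimately show ?thesis using less.prems by linarith
  next
    case 3
    then show ?thesis using step[OF 3 _ _ _ less.prems(1,2)] less.prems by simp
  qed
qed

lemma mform_nonneg_bound:
  assumes mk: "markoff m x y" and qb: "quadrant_bound m x y"
    and d: "m dvd s * x - t * y" and nz: "(s, t) \<noteq> (0, 0)" and q: "0 \<le> mform m s t"
  shows "m\<^sup>2 \<le> mform m s t"
proof -
  have neg: "mform m (- s) (- t) = mform m s t" by (simp add: mform_def)
  have d': "m dvd - s * x - - t * y" "m dvd - s * x + t * y"
    using d by (metis dvd_minus_iff minus_diff_eq mult_minus_left diff_minus_eq_add minus_mult_minus uminus_add_conv_diff)+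
  consider "0 \<le> s" "0 \<le> t" | "s \<le> 0" "t \<le> 0" | "0 < s" "t < 0" | "s < 0" "0 < t" by linarith
  then show ?thesis
  proof cases
    case 1
    then show ?thesis using qb nz d unfolding quadrant_bound_def by blast
  next
    case 2
    then have "0 \<le> - s" "0 \<le> - t" "(- s, - t) \<noteq> (0, 0)" using nz by auto
    then have "m\<^sup>2 \<le> mform m (- s) (- t)"
      using qb d' unfolding quadrant_bound_def by blast
    then show ?thesis using neg by simp
  next
    case 3
    then show ?thesis using mform_descent[OF mk qb, of s "- t"] d q by simp
  next
    case 4
    then show ?thesis using mform_descent[OF mk qb, of "- s" t] d' q neg by simp
  qed
qed

lemma mform_bound:
  assumes g: "good_triple m x y"
    and d: "m dvd s * x - t * y" and nz: "(s, t) \<noteq> (0, 0)"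
  shows "m\<^sup>2 \<le> \<bar>mform m s t\<bar>"
proof (cases "0 \<le> mform m s t")
  case True
  then show ?thesis using mform_nonneg_bound[OF _ _ d nz] g by (simp add: good_triple_def)
next
  case False
  have mk: "markoff m x y" and qb: "quadrant_bound m x y" using g by (auto simp: good_triple_def)
  have eq: "m\<^sup>2 + x\<^sup>2 + y\<^sup>2 = 3 * m * x * y" and m: "0 < m" using mk by (auto simp: markoff_def)
  obtain e where e: "s * x - t * y = m * e" using d by blast
  obtain f where f: "s * y + t * x = m * f" using dvd_rotate[OF mk] d by blast
  \<comment> \<open>The form takes the value \<open>- m\<^sup>2\<close> at \<open>w = (x, - y)\<close> and at its image \<open>w'\<close> under
    the automorph, and \<open>(s, t) = (a w + b w') / m\<close>.\<close>
  define a where "a = 3 * y * s - e"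
  define b where "b = - f"
  have ma: "m * a = 3 * m * y * s - s * x + t * y" using e by (simp add: a_def algebra_simps)
  have mb: "m * b = - s * y - t * x" using f by (simp add: b_def algebra_simps)
  have "m\<^sup>2 * mform m a b = (m * a)\<^sup>2 + (m * b)\<^sup>2 + 3 * m * (m * a) * (m * b)"
    by (simp add: mform_def algebra_simps power2_eq_square)
  also have "\<dots> = m\<^sup>2 * (- mform m s t)"
    unfolding ma mb mform_def using eq by algebra
  finally have ab: "mform m a b = - mform m s t"
    using m mult_left_cancel[of "m\<^sup>2" "mform m a b" "- mform m s t"] by simp
  have "m * (a * x + b * y) = m * (s * m)"
    unfolding distrib_left mult.assoc[symmetric] ma mb using eq by algebra
  then have "a * x + b * y = s * m" using m by simp
  then have "m dvd b * y + a * x" by (simp add: add.commute)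
  then have "m dvd b * x - a * y" using dvd_rotate[OF mk] by simp
  moreover have "(b, a) \<noteq> (0, 0)" using ab False by (auto simp: mform_def)
  ultimately have "m\<^sup>2 \<le> mform m b a"
    using mform_nonneg_bound[OF mk qb, of b a] ab False by (simp add: mform_commute[of m b a])
  then show ?thesis using ab by (simp add: mform_commute[of m b a])
qed

section \<open>The tree of Markoff triples\<close>

lemma Sigma_star_good:
  assumes "p \<in> Sigma_star"
  shows "case p of (m, m1, m2) \<Rightarrow> good_triple m m1 m2 \<and> m1 < m \<and> m2 < m"
  using assms
proof induction
  case root
  have "quadrant_bound 1 x y" for x y
    unfolding quadrant_bound_def mform_def
  proof (intro allI impI)
    fix s t :: int
    assume st: "0 \<le> s" "0 \<le> t" "(s, t) \<noteq> (0, 0)"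
    have "0 < s\<^sup>2 + t\<^sup>2" using st(3) by (simp add: sum_power2_gt_zero_iff)
    then show "1\<^sup>2 \<le> s\<^sup>2 + t\<^sup>2 + 3 * 1 * s * t" using st by (simp add: add_increasing2)
  qed
  moreover have "markoff 1 1 1" by (simp add: markoff_def)
  ultimately have "good_triple 1 1 1" by (simp add: good_triple_def)
  \<comment> \<open>\<open>2 = 3 * 1 * 1 - 1\<close>\<close>
  from good_triple_vieta[OF this] show ?case by simp
next
  case (succ p s n)
  obtain m m1 m2 where p: "p = (m, m1, m2)" by (metis prod_cases3)
  have g: "good_triple m m1 m2" and lt: "m1 < m" "m2 < m" using succ.IH by (auto simp: p)
  then have pos: "0 < m" "0 < m1" "0 < m2" by (auto simp: good_triple_def markoff_def)
  have mm: "m \<le> m * m1" "m \<le> m * m2" using pos by simp_all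
  show ?case
  proof (cases s)
    case Left
    have "good_triple (3 * m1 * m - m2) m1 m"
      using good_triple_vieta[of m2 m1 m] good_triple_swap g by blast
    moreover have "m < 3 * m * m1 - m2" using mm lt pos by linarith
    ultimately show ?thesis using succ.hyps Left lt pos
      by (auto simp: p markoff_succ_def algebra_simps)
  next
    case Right
    have "good_triple (3 * m * m2 - m1) m m2"
      using good_triple_vieta[of m1 m m2] good_triple_swap g by blast
    moreover have "m < 3 * m * m2 - m1" using mm lt pos by linarith
    ultimately show ?thesis using succ.hyps Right lt pos
      by (auto simp: p markoff_succ_def algebra_simps)
  qed
qed

lemma Sigma_star_bounds:
  assumes "(m, m1, m2) \<in> Sigma_star"
  shows "2 \<le> m" "0 < m1" "0 < m2" "m1 < m" "m2 < m"
  using Sigma_star_good[OF assms] by (auto simp: good_triple_def markoff_def)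

lemma fst_child_gt:
  assumes "p \<in> Sigma_star"
  shows "fst p < fst (markoff_child s p)"
proof -
  obtain m m1 m2 where p: "p = (m, m1, m2)" by (metis prod_cases3)
  note b = Sigma_star_bounds[OF assms[unfolded p]]
  have "m \<le> m * m1" "m \<le> m * m2" using b by simp_all
  then have "m < 3 * m * m1 - m2" "m < 3 * m * m2 - m1" using b by linarith+
  then show ?thesis by (cases s) (auto simp: p)
qed

lemma child_neq_root:
  assumes "p \<in> Sigma_star"
  shows "markoff_child s p \<noteq> (2, 1, 1)"
proof -
  obtain m m1 m2 where p: "p = (m, m1, m2)" by (metis prod_cases3)
  show ?thesis
    using fst_child_gt[OF assms, of s] Sigma_star_bounds(1)[OF assms[unfolded p]] p by auto
qed

text \<open>In a left child the second entry is smaller than the third one, in a right child it is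
  larger. So the child determines the side, and then the parent.\<close>
lemma markoff_child_inject:
  assumes "p \<in> Sigma_star" "p' \<in> Sigma_star" "markoff_child s p = markoff_child s' p'"
  shows "s = s' \<and> p = p'"
proof -
  obtain m m1 m2 n n1 n2 where p: "p = (m, m1, m2)" "p' = (n, n1, n2)" by (metis prod_cases3)
  show ?thesis
    using assms Sigma_star_bounds[OF assms(1)[unfolded p]] Sigma_star_bounds[OF assms(2)[unfolded p]]
    by (cases s; cases s') (auto simp: p)
qed

text \<open>The node at a given position below \<open>(5, 1, 2)\<close>.\<close>
abbreviation markoff_path :: "side list \<Rightarrow> triple" where
  "markoff_path w \<equiv> fold markoff_child w (5, 1, 2)"

lemma markoff_path_in_Sigma_star: "markoff_path w \<in> Sigma_star \<and> markoff_path w \<noteq> (2, 1, 1)"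
proof (induction w rule: rev_induct)
  case Nil
  have "(5, 1, 2) \<in> Sigma_star"
    by (rule Sigma_star.succ[OF Sigma_star.root, of Left]) (simp add: markoff_succ_def)
  then show ?case by simp
next
  case (snoc s w)
  have "markoff_succ s (markoff_path w) (markoff_path (w @ [s]))"
    using snoc by (simp add: markoff_succ_def)
  then have "markoff_path (w @ [s]) \<in> Sigma_star" using snoc Sigma_star.succ by blast
  then show ?case using snoc child_neq_root by auto
qed

lemma Sigma_star_path:
  assumes "p \<in> Sigma_star"
  shows "p = (2, 1, 1) \<or> (\<exists>w. p = markoff_path w)"
  using assms
proof induction
  case root
  show ?case by simp
next
  case (succ p s n)
  then consider "n = markoff_path []" | w where "n = markoff_path (w @ [s])"
    by (auto simp: markoff_succ_def)
  then show ?case by cases blast+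
qed

lemma markoff_path_snoc_neq: "markoff_path (u @ [s]) \<noteq> (5, 1, 2)"
proof
  assume "markoff_path (u @ [s]) = (5, 1, 2)"
  then have "markoff_child s (markoff_path u) = markoff_child Left (2, 1, 1)" by simp
  from markoff_child_inject[OF _ Sigma_star.root this] markoff_path_in_Sigma_star[of u]
  show False by blast
qed

lemma markoff_path_inject:
  "markoff_path v = markoff_path w \<Longrightarrow> v = w"
proof (induction v arbitrary: w rule: rev_induct)
  case Nil
  then show ?case by (cases w rule: rev_cases) (auto simp del: fold_append dest: markoff_path_snoc_neq[THEN notE, OF sym])
next
  case (snoc s v)
  have "w \<noteq> []" using snoc.prems markoff_path_snoc_neq[of v s] by (metis fold_simps(1))
  then obtain u t where w: "w = u @ [t]" by (metis rev_exhaust)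
  have "s = t \<and> markoff_path v = markoff_path u"
    using snoc.prems markoff_path_in_Sigma_star by (intro markoff_child_inject) (auto simp: w)
  then show ?case using snoc.IH w by simp
qed

lemma position_path: "position (markoff_path w) = w"
  unfolding position_def using markoff_path_inject by blast

section \<open>The numerators of the approximations\<close>

definition sym_mat :: "int \<Rightarrow> int \<Rightarrow> int \<Rightarrow> mat2" where
  "sym_mat m k l = vector [vector [m, k], vector [k, l]]"

lemma sym_mat_nth [simp]: "sym_mat m k l $ 1 $ 2 = k"
  by (simp add: sym_mat_def)

text \<open>In both kinds of children the new matrix is a product of this shape; the last two relations
  are those that \<open>matrix_node\<close> demands of the child.\<close>
lemma sym_mat_product:
  fixes a b c d e f n :: int
  assumes "a * c - b\<^sup>2 = 1" "d * f - e\<^sup>2 = 1" "b * d - a * e = n"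
    and "a\<^sup>2 + d\<^sup>2 + n\<^sup>2 = 3 * a * d * n" and "a \<noteq> 0" "d \<noteq> 0"
  obtains k l where "sym_mat a b c ** M_mat ** sym_mat d e f = sym_mat (3 * a * d - n) k l"
    and "(3 * a * d - n) * l - k\<^sup>2 = 1" and "k * d - (3 * a * d - n) * e = a"
    and "b * (3 * a * d - n) - a * k = d"
proof
  define k where "k = 3 * a * e - b * e + a * f"
  define l where "l = 3 * b * e - c * e + b * f"
  \<comment> \<open>The product is symmetric because of Markoff's equation.\<close>
  have "a * d * (k - (3 * b * d - c * d + b * e)) = 0"
    unfolding k_def using assms(1-4) by algebra
  then have k': "k = 3 * b * d - c * d + b * e" using assms(5,6) by simp
  have m: "3 * a * d - n = 3 * a * d - b * d + a * e" using assms(3) by simp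
  show "sym_mat a b c ** M_mat ** sym_mat d e f = sym_mat (3 * a * d - n) k l"
    unfolding m by (simp add: vec_eq_iff forall_2 sym_mat_def M_mat_def matrix_matrix_mult_def sum_2,
      simp add: l_def, simp add: k' , simp add: k'[symmetric], simp add: k_def algebra_simps)
  have "(3 * a * d - n) * l - k * (3 * b * d - c * d + b * e) = 1"
    unfolding m k_def l_def using assms(1,2) by algebra
  then show "(3 * a * d - n) * l - k\<^sup>2 = 1" by (simp add: k'[symmetric] power2_eq_square)
  show "k * d - (3 * a * d - n) * e = a"
    unfolding m k_def using assms(2) by algebra
  show "b * (3 * a * d - n) - a * k = d"
    unfolding m k' using assms(1) by algebra
qed

text \<open>The triple of matrices \<open>X\<close> may stand at the position of \<open>p\<close>: its members are symmetric of
  determinant 1, their upper left entries form the triple \<open>p\<close>, and the determinants formed by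
  the first row of the first matrix and that of either other matrix are, up to sign, the remaining
  entry of \<open>p\<close>.\<close>
definition matrix_node :: "triple \<Rightarrow> mat2 \<times> mat2 \<times> mat2 \<Rightarrow> bool" where
  "matrix_node p X \<longleftrightarrow> (\<exists>m m1 m2 k k1 k2 l l1 l2. p = (m, m1, m2) \<and>
     X = (sym_mat m k l, sym_mat m1 k1 l1, sym_mat m2 k2 l2) \<and>
     m * l - k\<^sup>2 = 1 \<and> m1 * l1 - k1\<^sup>2 = 1 \<and> m2 * l2 - k2\<^sup>2 = 1 \<and>
     k * m2 - m * k2 = m1 \<and> k1 * m - m1 * k = m2)"

lemma matrix_node_child:
  assumes "matrix_node p X" "p \<in> Sigma_star"
  shows "matrix_node (markoff_child s p) (matrix_child s X)"
proof -
  obtain m m1 m2 k k1 k2 l l1 l2 where p: "p = (m, m1, m2)"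
    and X: "X = (sym_mat m k l, sym_mat m1 k1 l1, sym_mat m2 k2 l2)"
    and det: "m * l - k\<^sup>2 = 1" "m1 * l1 - k1\<^sup>2 = 1" "m2 * l2 - k2\<^sup>2 = 1"
    and rel: "k * m2 - m * k2 = m1" "k1 * m - m1 * k = m2"
    using assms(1) unfolding matrix_node_def by blast
  have eq: "m\<^sup>2 + m1\<^sup>2 + m2\<^sup>2 = 3 * m * m1 * m2" and nz: "m \<noteq> 0" "m1 \<noteq> 0" "m2 \<noteq> 0"
    using Sigma_star_good[OF assms(2)] by (auto simp: p good_triple_def markoff_def)
  show ?thesis
  proof (cases s)
    case Left
    have "m1\<^sup>2 + m\<^sup>2 + m2\<^sup>2 = 3 * m1 * m * m2" using eq by (simp add: algebra_simps)
    from sym_mat_product[OF det(2) det(1) rel(2) this nz(2) nz(1)] obtain k' l' where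
      "sym_mat m1 k1 l1 ** M_mat ** sym_mat m k l = sym_mat (3 * m1 * m - m2) k' l'"
      "(3 * m1 * m - m2) * l' - k'\<^sup>2 = 1" "k' * m - (3 * m1 * m - m2) * k = m1"
      "k1 * (3 * m1 * m - m2) - m1 * k' = m" .
    moreover have "3 * m * m1 - m2 = 3 * m1 * m - m2" by simp
    ultimately show ?thesis unfolding matrix_node_def Left p X markoff_child.simps matrix_child.simps
      using det by (metis (no_types, lifting))
  next
    case Right
    have "m\<^sup>2 + m2\<^sup>2 + m1\<^sup>2 = 3 * m * m2 * m1" using eq by (simp add: algebra_simps)
    from sym_mat_product[OF det(1) det(3) rel(1) this nz(1) nz(3)] obtain k' l' where
      "sym_mat m k l ** M_mat ** sym_mat m2 k2 l2 = sym_mat (3 * m * m2 - m1) k' l'"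
      "(3 * m * m2 - m1) * l' - k'\<^sup>2 = 1" "k' * m2 - (3 * m * m2 - m1) * k2 = m"
      "k * (3 * m * m2 - m1) - m * k' = m2" .
    then show ?thesis unfolding matrix_node_def Right p X markoff_child.simps matrix_child.simps
      using det by (metis (no_types, lifting))
  qed
qed

lemma matrix_node_path: "matrix_node (markoff_path w) (fold matrix_child w matrix_root)"
proof (induction w rule: rev_induct)
  case Nil
  have "matrix_root = (sym_mat 5 3 2, sym_mat 1 1 2, sym_mat 2 1 1)"
    by (simp add: matrix_root_def sym_mat_def)
  then have "(5, 1, 2) = (5, 1, 2) \<and> matrix_root = (sym_mat 5 3 2, sym_mat 1 1 2, sym_mat 2 1 1) \<and>
      5 * 2 - 3\<^sup>2 = (1::int) \<and> 1 * 2 - 1\<^sup>2 = (1::int) \<and> 2 * 1 - 1\<^sup>2 = (1::int) \<and>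
      3 * 2 - 5 * 1 = (1::int) \<and> 1 * 5 - 1 * 3 = (2::int)"
    by simp
  then show ?case unfolding matrix_node_def fold_simps by blast
next
  case (snoc s w)
  from matrix_node_child[OF snoc conjunct1[OF markoff_path_in_Sigma_star], of s]
  show ?case by (simp only: fold_append fold_simps comp_apply)
qed

text \<open>The numerator of the rational approximation to \<open>\<xi>\<close> that belongs to a node; the denominator
  is the first entry of the node.\<close>
definition numer :: "triple \<Rightarrow> int" where
  "numer p = x_mat p $ 1 $ 2"

lemma numer_path: "numer (markoff_path w) = fst (fold matrix_child w matrix_root) $ 1 $ 2"
  using markoff_path_in_Sigma_star[of w] by (simp add: numer_def x_mat_def position_path)

lemma numer_root: "numer (2, 1, 1) = 1"
  by (simp add: numer_def x_mat_def)

lemma numer_dvd: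
  assumes "(m, m1, m2) \<in> Sigma_star"
  shows "m dvd numer (m, m1, m2) * m1 + m2"
  using Sigma_star_path[OF assms]
proof
  assume "(m, m1, m2) = (2, 1, 1)"
  then show ?thesis by (simp add: numer_root)
next
  assume "\<exists>w. (m, m1, m2) = markoff_path w"
  then obtain w where w: "(m, m1, m2) = markoff_path w" by blast
  have "matrix_node (m, m1, m2) (fold matrix_child w matrix_root)"
    using matrix_node_path[of w] w by simp
  then obtain k1 where "k1 * m - m1 * numer (m, m1, m2) = m2"
    unfolding w numer_path by (auto simp: matrix_node_def w[symmetric])
  then have "numer (m, m1, m2) * m1 + m2 = m * k1" by (simp add: algebra_simps)
  then show ?thesis by simp
qed

text \<open>The sign of the difference between the approximations of a child on the given side and of its
  parent; see \<open>numer_succ\<close>.\<close>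
fun side_sign :: "side \<Rightarrow> int" where
  "side_sign Left = 1"
| "side_sign Right = - 1"

text \<open>The one of the last two entries of a triple that is also one of the last two entries of its
  child on the given side.\<close>
fun kept_entry :: "side \<Rightarrow> triple \<Rightarrow> int" where
  "kept_entry Left (m, m1, m2) = m1"
| "kept_entry Right (m, m1, m2) = m2"

lemma numer_succ:
  assumes "p \<in> Sigma_star" "markoff_succ s p n"
  shows "numer n * fst p - fst n * numer p = side_sign s * kept_entry s p"
  using Sigma_star_path[OF assms(1)]
proof
  assume p: "p = (2, 1, 1)"
  then have s: "s = Left" and n: "n = markoff_path []"
    using assms(2) by (auto simp: markoff_succ_def)
  have "numer n = 3" unfolding n numer_path by (simp add: matrix_root_def)
  then show ?thesis by (simp add: p s n numer_root)
next
  assume "\<exists>w. p = markoff_path w"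
  then obtain w where w: "p = markoff_path w" by blast
  then have n: "n = markoff_path (w @ [s])" using assms(2) by (simp add: markoff_succ_def)
  obtain m m1 m2 where p: "p = (m, m1, m2)" by (metis prod_cases3)
  obtain X X1 X2 where X: "fold matrix_child w matrix_root = (X, X1, X2)" by (metis prod_cases3)
  have "matrix_node (markoff_child s p) (matrix_child s (X, X1, X2))"
    using matrix_node_path[of "w @ [s]"] w X by simp
  moreover have "numer p = X $ 1 $ 2" unfolding w numer_path X by simp
  moreover have "numer n = fst (matrix_child s (X, X1, X2)) $ 1 $ 2"
    unfolding n numer_path by (simp add: X)
  moreover have "n = markoff_child s p" using assms(2) by (simp add: markoff_succ_def)
  ultimately show ?thesis
    by (cases s) (auto simp: p matrix_node_def algebra_simps)
qed

section \<open>Zigzags\<close>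

lemma other_side_neq [simp]: "other_side s \<noteq> s"
  by (cases s) auto

lemma other_side_eqI: "s \<noteq> t \<Longrightarrow> s = other_side t"
  by (cases s; cases t) auto

lemma markoff_succ_side:
  assumes "p \<in> Sigma_star" "markoff_succ s p n" "markoff_succ t p n"
  shows "s = t"
  using assms markoff_child_inject unfolding markoff_succ_def by metis

lemma zigzag_sides:
  assumes z: "zigzag z" and s: "markoff_succ s (z 0) (z 1)"
  shows "markoff_succ ((other_side ^^ i) s) (z i) (z (Suc i))"
proof (induction i)
  case 0
  show ?case using s by simp
next
  case (Suc i)
  obtain t where t: "markoff_succ t (z i) (z (Suc i))"
      "markoff_succ (other_side t) (z (Suc i)) (z (Suc (Suc i)))"
    using z unfolding zigzag_def by blast
  have "z i \<in> Sigma_star" using z unfolding zigzag_def by blast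
  then have "t = (other_side ^^ i) s" using markoff_succ_side t Suc by blast
  then show ?case using t by simp
qed

lemma zigzag_exists:
  assumes m: "\<mm> \<in> Sigma_star" and s: "\<mm> = (2, 1, 1) \<longrightarrow> s = Left"
  shows "\<exists>z. zigzag z \<and> z 0 = \<mm> \<and> markoff_succ s \<mm> (z 1)"
proof -
  define z where "z = rec_nat \<mm> (\<lambda>i. markoff_child ((other_side ^^ i) s))"
  have z0: "z 0 = \<mm>" and zS: "z (Suc i) = markoff_child ((other_side ^^ i) s) (z i)" for i
    by (simp_all add: z_def)
  have "z i \<in> Sigma_star \<and> markoff_succ ((other_side ^^ i) s) (z i) (z (Suc i))" for i
  proof (induction i)
    case 0
    then show ?case using m s zS[of 0] by (simp add: z0 markoff_succ_def)
  next
    case (Suc i)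
    then have "z (Suc i) \<in> Sigma_star" using Sigma_star.succ by blast
    moreover have "z (Suc i) \<noteq> (2, 1, 1)" using Suc child_neq_root by (simp add: zS)
    ultimately show ?case using zS[of "Suc i"] by (simp add: markoff_succ_def)
  qed
  note * = this
  have "zigzag z" unfolding zigzag_def
  proof (intro conjI allI)
    show "\<exists>t. markoff_succ t (z i) (z (Suc i)) \<and>
        markoff_succ (other_side t) (z (Suc i)) (z (Suc (Suc i)))" for i
      using *[of i] *[of "Suc i"] by auto
  qed (use * in blast)
  then show ?thesis using z0 *[of 0] by auto
qed

text \<open>A zigzag is maximal iff its first step is on the side on which its first node is a
  successor (on the left if the first node is the root).\<close>
lemma maximal_zigzag_side:
  assumes m: "\<mm> \<in> Sigma_star"
  obtains t where "\<mm> = (2, 1, 1) \<longrightarrow> t = Left"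
    and "\<And>z. zigzag z \<Longrightarrow> z 0 = \<mm> \<Longrightarrow> maximal_zigzag z \<longleftrightarrow> markoff_succ t \<mm> (z 1)"
  using m
proof cases
  case root
  show ?thesis
  proof (rule that[of Left])
    fix z assume z: "zigzag z" "z 0 = \<mm>"
    have "\<exists>s. markoff_succ s (z 0) (z (Suc 0))" using z(1) unfolding zigzag_def by blast
    then have "markoff_succ Left \<mm> (z 1)" using z root by (auto simp: markoff_succ_def)
    moreover have "\<not> zigzag (case_nat a z)" for a
    proof
      assume a: "zigzag (case_nat a z)"
      then have "case_nat a z 0 \<in> Sigma_star"
        "\<exists>s. markoff_succ s (case_nat a z 0) (case_nat a z (Suc 0))"
        unfolding zigzag_def by blast+
      then obtain s where "a \<in> Sigma_star" "(2, 1, 1) = markoff_child s a"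
        using z root by (auto simp: markoff_succ_def)
      then show False using child_neq_root by metis
    qed
    ultimately show "maximal_zigzag z \<longleftrightarrow> markoff_succ Left \<mm> (z 1)"
      using z by (simp add: maximal_zigzag_def)
  qed simp
next
  case (succ p t)
  show ?thesis
  proof (rule that[of t])
    show "\<mm> = (2, 1, 1) \<longrightarrow> t = Left"
      using succ child_neq_root by (auto simp: markoff_succ_def)
    fix z assume z: "zigzag z" "z 0 = \<mm>"
    obtain s where s: "markoff_succ s \<mm> (z 1)" using z unfolding zigzag_def by (metis One_nat_def)
    show "maximal_zigzag z \<longleftrightarrow> markoff_succ t \<mm> (z 1)"
    proof
      assume max: "maximal_zigzag z"
      have "s = t"
      proof (rule ccontr)
        assume "s \<noteq> t"
        then have "s = other_side t" by (rule other_side_eqI)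
        then have first: "markoff_succ t p (z 0)" "markoff_succ (other_side t) (z 0) (z (Suc 0))"
          using succ s z by auto
        have "zigzag (case_nat p z)" unfolding zigzag_def
        proof (intro conjI allI)
          show "case_nat p z i \<in> Sigma_star" for i
            using succ z by (cases i) (auto simp: zigzag_def)
          show "\<exists>s. markoff_succ s (case_nat p z i) (case_nat p z (Suc i)) \<and>
              markoff_succ (other_side s) (case_nat p z (Suc i)) (case_nat p z (Suc (Suc i)))" for i
          proof (cases i)
            case 0
            then show ?thesis using first by auto
          next
            case (Suc j)
            then show ?thesis using z(1) by (simp add: zigzag_def)
          qed
        qed
        then show False using max unfolding maximal_zigzag_def by blast
      qed
      then show "markoff_succ t \<mm> (z 1)" using s by simp
    next
      assume t: "markoff_succ t \<mm> (z 1)"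
      have "\<not> zigzag (case_nat a z)" for a
      proof
        assume a: "zigzag (case_nat a z)"
        then have "case_nat a z 0 \<in> Sigma_star" unfolding zigzag_def by blast
        then have a_in: "a \<in> Sigma_star" by simp
        have "\<exists>s. markoff_succ s (case_nat a z 0) (case_nat a z (Suc 0)) \<and>
            markoff_succ (other_side s) (case_nat a z (Suc 0)) (case_nat a z (Suc (Suc 0)))"
          using a unfolding zigzag_def by blast
        then obtain s where s: "markoff_succ s a \<mm>" "markoff_succ (other_side s) \<mm> (z 1)"
          using z by auto
        have "s = t"
          using markoff_child_inject[OF a_in succ(1)] s(1) succ(2)
          unfolding markoff_succ_def by metis
        moreover have "other_side s = t" by (rule markoff_succ_side[OF m s(2) t])
        ultimately show False by simp
      qed
      then show "maximal_zigzag z" using z by (simp add: maximal_zigzag_def)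
    qed
  qed
qed

text \<open>The properties of zigzags used below hold for maximal and other zigzags alike; maximality
  serves only to make \<open>zigzag_from\<close> well defined.\<close>
lemma zigzag_from:
  assumes m: "\<mm> \<in> Sigma_star"
  shows "zigzag (zigzag_from \<mm>)"
proof -
  obtain t where t: "\<mm> = (2, 1, 1) \<longrightarrow> t = Left"
    and max: "\<And>z. zigzag z \<Longrightarrow> z 0 = \<mm> \<Longrightarrow> maximal_zigzag z \<longleftrightarrow> markoff_succ t \<mm> (z 1)"
    using maximal_zigzag_side[OF m] by blast
  obtain z where z: "zigzag z" "z 0 = \<mm>" "markoff_succ t \<mm> (z 1)"
    using zigzag_exists[OF m t] by blast
  have "\<exists>!z. maximal_zigzag z \<and> z 0 = \<mm>"
  proof (rule ex1I[of _ z])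
    show "maximal_zigzag z \<and> z 0 = \<mm>" using z max by blast
    fix y assume y: "maximal_zigzag y \<and> y 0 = \<mm>"
    then have y': "zigzag y" "markoff_succ t \<mm> (y 1)" using max by (auto simp: maximal_zigzag_def)
    have "y i = z i" for i
    proof (induction i)
      case 0
      show ?case using y z by simp
    next
      case (Suc i)
      then show ?case
        using zigzag_sides[of y t i] zigzag_sides[of z t i] y y' z
        by (simp add: markoff_succ_def)
    qed
    then show "y = z" by (rule ext)
  qed
  from theI'[OF this] show ?thesis by (simp add: zigzag_from_def maximal_zigzag_def)
qed

lemma side_sign_funpow: "side_sign ((other_side ^^ i) s) = (- 1) ^ i * side_sign s"
proof (induction i)
  case (Suc i)
  have "side_sign (other_side t) = - side_sign t" for t by (cases t) auto
  then show ?case using Suc by simp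
qed simp

text \<open>From the second node on, the retained entry is the first entry of the preceding node.\<close>
lemma zigzag_recurrence:
  assumes z: "zigzag z"
  shows "2 \<le> fst (z i)" "fst (z i) < fst (z (Suc i))"
    and "\<exists>c. fst (z (Suc (Suc i))) = 3 * fst (z (Suc i)) * fst (z i) - c \<and> 0 < c \<and> c < fst (z i)"
    and "\<exists>e. \<bar>e\<bar> = 1 \<and> (\<forall>i. numer (z (Suc (Suc i))) * fst (z (Suc i))
           - fst (z (Suc (Suc i))) * numer (z (Suc i)) = e * (- 1) ^ i * fst (z i))"
proof -
  have inS: "z i \<in> Sigma_star" for i using z unfolding zigzag_def by blast
  obtain s where "markoff_succ s (z 0) (z 1)" using z unfolding zigzag_def by (metis One_nat_def)
  note sides = zigzag_sides[OF z this]
  define t where "t i = (other_side ^^ i) s" for i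
  have zS: "z (Suc i) = markoff_child (t i) (z i)" for i
    using sides[of i] by (simp add: markoff_succ_def t_def)
  have tS: "t (Suc i) = other_side (t i)" for i by (simp add: t_def)
  obtain m m1 m2 where zi: "z i = (m, m1, m2)" by (metis prod_cases3)
  note b = Sigma_star_bounds[OF inS[of i, unfolded zi]]
  show "2 \<le> fst (z i)" using b zi by simp
  show "fst (z i) < fst (z (Suc i))" using fst_child_gt[OF inS] by (simp add: zS)
  have "fst (markoff_child (other_side u) (markoff_child u p)) =
      3 * fst (markoff_child u p) * fst p - kept_entry u p" for u p
    by (cases p; cases u) auto
  then have "fst (z (Suc (Suc i))) = 3 * fst (z (Suc i)) * fst (z i) - kept_entry (t i) (z i)"
    by (simp add: zS tS)
  moreover have "0 < kept_entry (t i) (z i)" "kept_entry (t i) (z i) < fst (z i)"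
    using b zi by (cases "t i"; simp)+
  ultimately show "\<exists>c. fst (z (Suc (Suc i))) = 3 * fst (z (Suc i)) * fst (z i) - c \<and> 0 < c \<and> c < fst (z i)"
    by blast
  have "kept_entry (other_side u) (markoff_child u p) = fst p" for u p
    by (cases p; cases u) auto
  then have kept: "kept_entry (t (Suc i)) (z (Suc i)) = fst (z i)" for i
    by (simp add: zS tS)
  have "\<bar>- side_sign s\<bar> = 1" by (cases s) auto
  moreover have "numer (z (Suc (Suc i))) * fst (z (Suc i)) - fst (z (Suc (Suc i))) * numer (z (Suc i))
      = - side_sign s * (- 1) ^ i * fst (z i)" for i
    using numer_succ[OF inS sides[of "Suc i"]] kept[of i] side_sign_funpow[of "Suc i" s]
    by (simp add: t_def)
  ultimately show "\<exists>e. \<bar>e\<bar> = 1 \<and> (\<forall>i. numer (z (Suc (Suc i))) * fst (z (Suc i))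
           - fst (z (Suc (Suc i))) * numer (z (Suc i)) = e * (- 1) ^ i * fst (z i))"
    by blast
qed

section \<open>The limit along a zigzag\<close>

text \<open>Leibniz's criterion with its error bound, for sequences with alternating differences.\<close>
lemma alternating_convergence:
  fixes p d :: "nat \<Rightarrow> real"
  assumes step: "\<And>n. p (Suc n) - p n = e * (- 1) ^ n * d n" and e: "\<bar>e\<bar> = 1"
    and d: "\<And>n. 0 \<le> d n" "\<And>n. d (Suc n) \<le> d n" "d \<longlonglongrightarrow> 0"
  obtains L where "p \<longlonglongrightarrow> L" "\<And>n. \<bar>p n - L\<bar> \<le> d n"
proof -
  have tail: "summable (\<lambda>i. (- 1) ^ i * d (i + n)) \<and> \<bar>\<Sum>i. (- 1) ^ i * d (i + n)\<bar> \<le> d n" for n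
  proof -
    have a: "(\<lambda>i. d (i + n)) \<longlonglongrightarrow> 0" "\<And>i. 0 \<le> d (i + n)" "\<And>i. d (Suc i + n) \<le> d (i + n)"
      using d by (auto intro: LIMSEQ_ignore_initial_segment)
    note L = summable_Leibniz'[OF a]
    have "0 \<le> (\<Sum>i. (- 1) ^ i * d (i + n))" using L(2)[of 0] by simp
    moreover have "(\<Sum>i. (- 1) ^ i * d (i + n)) \<le> d n" using L(4)[of 0] by simp
    ultimately show ?thesis using L(1) by simp
  qed
  have psum: "p (k + n) = p n + e * (- 1) ^ n * (\<Sum>i<k. (- 1) ^ i * d (i + n))" for k n
  proof (induction k)
    case (Suc k)
    have "p (Suc k + n) = p (k + n) + e * (- 1) ^ (k + n) * d (k + n)"
      using step[of "k + n"] by simp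
    then show ?case using Suc by (simp add: algebra_simps power_add)
  qed simp
  have lim: "(\<lambda>k. p (k + n)) \<longlonglongrightarrow> p n + e * (- 1) ^ n * (\<Sum>i. (- 1) ^ i * d (i + n))" for n
    unfolding psum using tail[of n] by (intro tendsto_intros summable_LIMSEQ) auto
  define L where "L = p 0 + e * (\<Sum>i. (- 1) ^ i * d i)"
  have pL: "p \<longlonglongrightarrow> L" using lim[of 0] by (simp add: L_def)
  have "\<bar>p n - L\<bar> \<le> d n" for n
  proof -
    have "L = p n + e * (- 1) ^ n * (\<Sum>i. (- 1) ^ i * d (i + n))"
      using LIMSEQ_unique[OF LIMSEQ_ignore_initial_segment[OF pL] lim[of n]] .
    then have "\<bar>p n - L\<bar> = \<bar>e\<bar> * \<bar>\<Sum>i. (- 1) ^ i * d (i + n)\<bar>" by (simp add: abs_mult)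
    then show ?thesis using tail[of n] e by simp
  qed
  with pL show ?thesis by (rule that)
qed

abbreviation denom :: "triple \<Rightarrow> real" where
  "denom p \<equiv> real_of_int (fst p)"

text \<open>The ratio \<open>k / m\<close> in the first row of the matrix of a node.\<close>
definition approx :: "triple \<Rightarrow> real" where
  "approx p = real_of_int (numer p) / denom p"

lemma zigzag_fst_ge:
  assumes "zigzag z"
  shows "int i + 2 \<le> fst (z i)"
proof (induction i)
  case 0
  show ?case using zigzag_recurrence(1)[OF assms, of 0] by simp
next
  case (Suc i)
  then show ?case using zigzag_recurrence(2)[OF assms, of i] by simp
qed

lemma inverse_zigzag_fst_tendsto_0:
  assumes "zigzag z"
  shows "(\<lambda>i. 1 / denom (z i)) \<longlonglongrightarrow> 0"
proof (rule tendsto_sandwich[OF _ _ tendsto_const lim_1_over_n])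
  have ge: "real i \<le> denom (z i)" "0 < denom (z i)" for i
    using zigzag_fst_ge[OF assms, of i] by linarith+
  show "\<forall>\<^sub>F i in sequentially. 1 / denom (z i) \<le> 1 / real i"
    by (rule eventually_sequentiallyI[of 1]) (use ge in \<open>intro frac_le; simp\<close>)
  show "\<forall>\<^sub>F i in sequentially. 0 \<le> 1 / denom (z i)"
    using ge by (intro always_eventually allI) (simp add: less_imp_le)
qed

lemma zigzag_approx_limit:
  assumes z: "zigzag z"
  obtains L where "(\<lambda>i. approx (z i)) \<longlonglongrightarrow> L"
    and "\<And>i. (denom (z (Suc i)))\<^sup>2 * \<bar>approx (z (Suc i)) - L\<bar> \<le> 1 / (3 - 1 / denom (z (Suc i)))"
proof -
  define M where "M i = denom (z i)" for i
  define d where "d i = M i / (M (Suc i) * M (Suc (Suc i)))" for i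
  have M2: "2 \<le> M i" and Mlt: "M i < M (Suc i)" for i
    using zigzag_recurrence(1,2)[OF z, of i] unfolding M_def by linarith+
  have Mpos: "0 < M i" for i using M2[of i] by linarith
  have rec: "\<exists>c. M (Suc (Suc i)) = 3 * M (Suc i) * M i - c \<and> 0 < c \<and> c < M i" for i
  proof -
    obtain c where c: "fst (z (Suc (Suc i))) = 3 * fst (z (Suc i)) * fst (z i) - c" "0 < c" "c < fst (z i)"
      using zigzag_recurrence(3)[OF z, of i] by blast
    show ?thesis
      by (rule exI[of _ "real_of_int c"]) (use c in \<open>simp add: M_def\<close>)
  qed
  obtain e where e: "\<bar>e\<bar> = 1" and numer: "numer (z (Suc (Suc i))) * fst (z (Suc i))
           - fst (z (Suc (Suc i))) * numer (z (Suc i)) = e * (- 1) ^ i * fst (z i)" for i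
    using zigzag_recurrence(4)[OF z] by blast
  have step: "approx (z (Suc (Suc n))) - approx (z (Suc n)) = real_of_int e * (- 1) ^ n * d n" for n
  proof -
    have "approx (z (Suc (Suc n))) - approx (z (Suc n)) =
        (real_of_int (numer (z (Suc (Suc n)))) * M (Suc n)
           - M (Suc (Suc n)) * real_of_int (numer (z (Suc n)))) / (M (Suc n) * M (Suc (Suc n)))"
      using Mpos[of "Suc n"] Mpos[of "Suc (Suc n)"]
      unfolding approx_def M_def[symmetric] by (simp add: field_simps)
    also have "real_of_int (numer (z (Suc (Suc n)))) * M (Suc n)
           - M (Suc (Suc n)) * real_of_int (numer (z (Suc n))) = real_of_int (e * (- 1) ^ n * fst (z n))"
      unfolding numer[symmetric] by (simp add: M_def)
    finally show ?thesis by (simp add: d_def M_def)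
  qed
  have d0: "0 \<le> d n" for n unfolding d_def using Mpos by (simp add: less_imp_le)
  \<comment> \<open>This says that \<open>d\<close> is decreasing.\<close>
  have MM: "M (Suc n) * M (Suc n) \<le> M n * M (Suc (Suc (Suc n)))" for n
  proof -
    obtain c where c: "M (Suc (Suc (Suc n))) = 3 * M (Suc (Suc n)) * M (Suc n) - c" "c < M (Suc n)"
      using rec[of "Suc n"] by blast
    have 1: "1 * M (Suc n) \<le> M (Suc (Suc n)) * M (Suc n)"
      using M2[of "Suc (Suc n)"] Mpos[of "Suc n"] by (intro mult_right_mono) auto
    have 2: "M (Suc n) * M (Suc n) \<le> M (Suc (Suc n)) * M (Suc n)"
      using Mlt[of "Suc n"] Mpos[of "Suc n"] by (intro mult_right_mono) auto
    have "M (Suc n) * M (Suc n) \<le> M (Suc (Suc (Suc n)))" using 1 2 c Mpos[of "Suc n"] by linarith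
    also have "\<dots> \<le> M n * M (Suc (Suc (Suc n)))"
      using M2[of n] Mpos[of "Suc (Suc (Suc n))"] by simp
    finally show ?thesis .
  qed
  have dec: "d (Suc n) \<le> d n" for n
  proof -
    have "M (Suc n) / M (Suc (Suc (Suc n))) \<le> M n / M (Suc n)"
      using MM[of n] Mpos by (simp add: divide_simps mult.commute)
    then have "M (Suc n) / M (Suc (Suc (Suc n))) / M (Suc (Suc n)) \<le> M n / M (Suc n) / M (Suc (Suc n))"
      using Mpos[of "Suc (Suc n)"] by (intro divide_right_mono) auto
    then show ?thesis by (simp add: d_def mult.commute)
  qed
  have "d \<longlonglongrightarrow> 0"
  proof (rule tendsto_sandwich[OF _ _ tendsto_const])
    show "(\<lambda>i. 1 / M (Suc (Suc i))) \<longlonglongrightarrow> 0"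
      using LIMSEQ_ignore_initial_segment[OF inverse_zigzag_fst_tendsto_0[OF z], of 2]
      by (simp add: M_def)
    have "d i \<le> 1 / M (Suc (Suc i))" for i
      using Mpos[of "Suc i"] Mpos[of "Suc (Suc i)"] Mlt[of i] by (simp add: d_def divide_simps)
    then show "\<forall>\<^sub>F i in sequentially. d i \<le> 1 / M (Suc (Suc i))" by simp
  qed (use d0 in simp)
  from alternating_convergence[of "\<lambda>i. approx (z (Suc i))", OF step _ d0 dec this] e
  obtain L where L: "(\<lambda>i. approx (z (Suc i))) \<longlonglongrightarrow> L" "\<And>n. \<bar>approx (z (Suc n)) - L\<bar> \<le> d n"
    by (metis of_int_1 of_int_abs)
  show ?thesis
  proof (rule that[of L])
    show "(\<lambda>i. approx (z i)) \<longlonglongrightarrow> L" using L(1) by (rule LIMSEQ_imp_Suc)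
    fix i
    obtain c where c: "M (Suc (Suc i)) = 3 * M (Suc i) * M i - c" "c < M i"
      using rec by blast
    have "(M (Suc i))\<^sup>2 * \<bar>approx (z (Suc i)) - L\<bar> \<le> (M (Suc i))\<^sup>2 * d i"
      using L(2) by (intro mult_left_mono) auto
    also have "\<dots> = M (Suc i) * M i / M (Suc (Suc i))"
      using Mpos[of "Suc i"] by (simp add: d_def power2_eq_square)
    also have "\<dots> \<le> M (Suc i) * M i / ((3 * M (Suc i) - 1) * M i)"
    proof (rule divide_left_mono)
      show "(3 * M (Suc i) - 1) * M i \<le> M (Suc (Suc i))" using c by (simp add: algebra_simps)
      show "0 < M (Suc (Suc i)) * ((3 * M (Suc i) - 1) * M i)"
        using M2[of "Suc i"] Mpos by simp
    qed (use Mpos in \<open>simp add: less_imp_le\<close>)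
    also have "\<dots> = 1 / (3 - 1 / M (Suc i))"
      using Mpos[of i] M2[of "Suc i"] by (simp add: divide_simps)
    finally show "(denom (z (Suc i)))\<^sup>2 * \<bar>approx (z (Suc i)) - L\<bar> \<le> 1 / (3 - 1 / denom (z (Suc i)))"
      by (simp add: M_def)
  qed
qed

text \<open>Indeed \<open>k / m - \<alpha> = (3 m - sqrt (9 m\<^sup>2 - 4)) / (2 m)\<close>.\<close>
lemma alpha_approx_tendsto_0:
  assumes z: "zigzag z"
  shows "(\<lambda>i. alpha (z i) - approx (z i)) \<longlonglongrightarrow> 0"
proof (rule tendsto_0_le[OF inverse_zigzag_fst_tendsto_0[OF z], of _ 1])
  have "\<bar>alpha (z i) - approx (z i)\<bar> \<le> 1 / denom (z i)" for i
  proof -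
    define m where "m = denom (z i)"
    have m: "2 \<le> m" using zigzag_recurrence(1)[OF z, of i] unfolding m_def by linarith
    define r where "r = sqrt (9 * m\<^sup>2 - 4)"
    have "(3 * m - 1)\<^sup>2 \<le> 9 * m\<^sup>2 - 4" using m by (simp add: power2_eq_square algebra_simps)
    then have lo: "3 * m - 1 \<le> r" unfolding r_def by (rule real_le_rsqrt)
    have hi: "r \<le> 3 * m" unfolding r_def using m by (intro real_le_lsqrt) (auto simp: power2_eq_square)
    have "alpha (z i) - approx (z i) = (r - 3 * m) / (2 * m)"
      using m unfolding alpha_def approx_def numer_def Let_def m_def[symmetric] r_def[symmetric]
      by (simp add: field_simps)
    then have "\<bar>alpha (z i) - approx (z i)\<bar> = (3 * m - r) / (2 * m)" using hi m by simp
    also have "\<dots> \<le> 1 / m" using lo m by (simp add: divide_simps)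
    finally show ?thesis by (simp add: m_def)
  qed
  then show "\<forall>\<^sub>F i in sequentially. norm (alpha (z i) - approx (z i)) \<le>
      norm (1 / denom (z i)) * 1"
    by (intro always_eventually allI) (metis abs_ge_self mult.right_neutral order_trans real_norm_def)
qed

lemma xi_approximations:
  assumes m: "\<mm> \<in> Sigma_star"
  obtains z where "zigzag z" "(\<lambda>i. approx (z i)) \<longlonglongrightarrow> xi \<mm>"
    and "\<And>i. (denom (z (Suc i)))\<^sup>2 * \<bar>approx (z (Suc i)) - xi \<mm>\<bar> \<le> 1 / (3 - 1 / denom (z (Suc i)))"
proof -
  note z = zigzag_from[OF m]
  obtain L where L: "(\<lambda>i. approx (zigzag_from \<mm> i)) \<longlonglongrightarrow> L"
    "\<And>i. (denom (zigzag_from \<mm> (Suc i)))\<^sup>2 * \<bar>approx (zigzag_from \<mm> (Suc i)) - L\<bar>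
       \<le> 1 / (3 - 1 / denom (zigzag_from \<mm> (Suc i)))"
    using zigzag_approx_limit[OF z] by blast
  have "(\<lambda>i. alpha (zigzag_from \<mm> i)) \<longlonglongrightarrow> L"
    using tendsto_add[OF alpha_approx_tendsto_0[OF z] L(1)] by simp
  then have "xi \<mm> = L" unfolding xi_def by (rule limI)
  then show ?thesis using that[OF z] L by blast
qed

section \<open>The minimum of the form and the Lagrange constant\<close>

text \<open>The substitution \<open>s = m T - k U\<close>, \<open>t = U\<close> turns the lattice bound into a bound for the
  Markoff form divided by \<open>m\<close>.\<close>
lemma approx_form_bound:
  fixes T U :: int
  assumes "p \<in> Sigma_star" and nz: "(U, T) \<noteq> (0, 0)"
  shows "1 \<le> \<bar>(T - approx p * U)\<^sup>2 + 3 * (T - approx p * U) * U + (1 / denom p * U)\<^sup>2\<bar>"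
proof -
  obtain m m1 m2 where p: "p = (m, m1, m2)" by (metis prod_cases3)
  have m: "0 < m" using Sigma_star_bounds[OF assms(1)[unfolded p]] by simp
  define k where "k = numer p"
  have fst_p: "fst p = m" by (simp add: p)
  have dvd: "m dvd k * m1 + m2" using numer_dvd assms(1) unfolding p k_def by blast
  have "(m * T - k * U) * m1 - U * m2 = m * (T * m1) - U * (k * m1 + m2)"
    by (simp add: algebra_simps)
  also have "m dvd \<dots>" using dvd by (intro dvd_diff) auto
  finally have "m dvd (m * T - k * U) * m1 - U * m2" .
  moreover have "(m * T - k * U, U) \<noteq> (0, 0)" using nz m by auto
  moreover have "good_triple m m1 m2" using Sigma_star_good[OF assms(1)] by (simp add: p)
  ultimately have "m\<^sup>2 \<le> \<bar>mform m (m * T - k * U) U\<bar>" using mform_bound by blast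
  then have "(real_of_int m)\<^sup>2 \<le> \<bar>real_of_int (mform m (m * T - k * U) U)\<bar>"
    by (metis of_int_abs of_int_le_iff of_int_power)
  also have "real_of_int (mform m (m * T - k * U) U) =
      (real_of_int m)\<^sup>2 * ((T - approx p * U)\<^sup>2 + 3 * (T - approx p * U) * U + (1 / denom p * U)\<^sup>2)"
    using m unfolding mform_def approx_def k_def[symmetric] fst_p
    by (simp add: field_simps power2_eq_square)
  finally have "(real_of_int m)\<^sup>2 * 1 \<le> (real_of_int m)\<^sup>2 *
      \<bar>(T - approx p * U)\<^sup>2 + 3 * (T - approx p * U) * U + (1 / denom p * U)\<^sup>2\<bar>"
    by (simp add: abs_mult)
  then show ?thesis using m by (simp only: mult_le_cancel_left_pos zero_less_power of_int_0_less_iff)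
qed

lemma G_form_bound:
  fixes x y :: int
  assumes m: "\<mm> \<in> Sigma_star" and nz: "(x, y) \<noteq> (0, 0)"
  shows "1 \<le> \<bar>G_form \<mm> x y\<bar>"
proof -
  obtain z where z: "zigzag z" "(\<lambda>i. approx (z i)) \<longlonglongrightarrow> xi \<mm>"
    using xi_approximations[OF m] by blast
  have inS: "z i \<in> Sigma_star" for i using z unfolding zigzag_def by blast
  \<comment> \<open>The shift replaces the roots \<open>\<xi>\<close> and \<open>\<xi> + 3\<close> of the form by \<open>\<xi> - 3\<close> and \<open>\<xi>\<close>.\<close>
  define T where "T = y - 3 * x"
  let ?f = "\<lambda>i. \<bar>(T - approx (z i) * x)\<^sup>2 + 3 * (T - approx (z i) * x) * x + (1 / denom (z i) * x)\<^sup>2\<bar>"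
  have "?f \<longlonglongrightarrow> \<bar>(T - xi \<mm> * x)\<^sup>2 + 3 * (T - xi \<mm> * x) * x + (0 * real_of_int x)\<^sup>2\<bar>"
    by (intro tendsto_intros z inverse_zigzag_fst_tendsto_0)
  moreover have "1 \<le> ?f i" for i
    using approx_form_bound[OF inS[of i], of x T] nz by (auto simp: T_def)
  ultimately have "1 \<le> \<bar>(T - xi \<mm> * x)\<^sup>2 + 3 * (T - xi \<mm> * x) * x + (0 * real_of_int x)\<^sup>2\<bar>"
    by (intro LIMSEQ_le_const) auto
  also have "(T - xi \<mm> * x)\<^sup>2 + 3 * (T - xi \<mm> * x) * x + (0 * real_of_int x)\<^sup>2 = G_form \<mm> x y"
    by (simp add: G_form_def T_def algebra_simps power2_eq_square)
  finally show ?thesis .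
qed

lemma form_min_G_form:
  assumes "\<mm> \<in> Sigma_star"
  shows "form_min (G_form \<mm>) = 1"
  unfolding form_min_def
proof (rule cInf_eq_minimum)
  show "1 \<in> {\<bar>G_form \<mm> (of_int x) (of_int y)\<bar> | x y :: int. (x, y) \<noteq> (0, 0)}"
    by (rule CollectI, rule exI[of _ 0], rule exI[of _ 1]) (simp add: G_form_def)
qed (use G_form_bound[OF assms] in auto)

lemma lagrange_lower:
  assumes m: "\<mm> \<in> Sigma_star"
  shows "ereal (1 / 3) \<le> lagrange_const (xi \<mm>)"
proof -
  have bound: "1 / (3 + 1 / real q) \<le> real q * int_dist (real q * xi \<mm>)" if q: "1 \<le> q" for q
  proof -
    define p where "p = round (real q * xi \<mm>)"
    define d where "d = int_dist (real q * xi \<mm>)"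
    have d: "d = \<bar>p - xi \<mm> * q\<bar>"
      by (simp add: d_def p_def int_dist_def dist_real_def mult.commute abs_minus_commute)
    have d1: "d \<le> 1"
      using of_int_round_abs_le[of "real q * xi \<mm>"] unfolding d p_def by (simp add: mult.commute)
    have "1 \<le> \<bar>G_form \<mm> (int q) p\<bar>" using q by (intro G_form_bound m) auto
    also have "G_form \<mm> (int q) p = (p - xi \<mm> * q) * ((p - xi \<mm> * q) - 3 * q)"
      by (simp add: G_form_def algebra_simps)
    also have "\<bar>\<dots>\<bar> = d * \<bar>(p - xi \<mm> * q) - 3 * q\<bar>"
      by (simp add: d abs_mult)
    also have "\<dots> \<le> d * (d + 3 * q)"
      by (intro mult_left_mono) (auto simp: d)
    also have "\<dots> \<le> d * (1 + 3 * q)"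
      using d1 by (intro mult_left_mono) (auto simp: d)
    also have "\<dots> = (3 + 1 / real q) * (q * d)" using q by (simp add: field_simps)
    finally show ?thesis unfolding d_def[symmetric] using q
      by (simp add: divide_le_eq add_pos_pos mult.commute)
  qed
  have "(\<lambda>q. ereal (1 / (3 + 1 / real q))) \<longlonglongrightarrow> ereal (1 / (3 + 0))"
    by (intro tendsto_intros lim_1_over_n) auto
  then have "ereal (1 / 3) = liminf (\<lambda>q. ereal (1 / (3 + 1 / real q)))"
    using lim_imp_Liminf by force
  also have "\<dots> \<le> lagrange_const (xi \<mm>)"
    unfolding lagrange_const_def
    by (intro Liminf_mono eventually_sequentiallyI[of 1]) (use bound in simp)
  finally show ?thesis .
qed

lemma lagrange_upper:
  assumes m: "\<mm> \<in> Sigma_star"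
  shows "lagrange_const (xi \<mm>) \<le> ereal (1 / 3)"
proof -
  obtain z where z: "zigzag z" and near:
    "\<And>i. (denom (z (Suc i)))\<^sup>2 * \<bar>approx (z (Suc i)) - xi \<mm>\<bar> \<le> 1 / (3 - 1 / denom (z (Suc i)))"
    using xi_approximations[OF m] by blast
  define q where "q i = nat (fst (z (Suc i)))" for i
  have q: "real (q i) = denom (z (Suc i))" and q0: "0 < fst (z (Suc i))" for i
    using zigzag_recurrence(1)[OF z, of "Suc i"] by (auto simp: q_def)
  have mono: "strict_mono q"
    unfolding strict_mono_Suc_iff q_def
  proof
    fix n
    show "nat (fst (z (Suc n))) < nat (fst (z (Suc (Suc n))))"
      using zigzag_recurrence(2)[OF z, of "Suc n"] q0[of n] by linarith
  qed
  define g where "g n = ereal (real n * int_dist (real n * xi \<mm>))" for n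
  have bound: "g (q i) \<le> ereal (1 / (3 - 1 / denom (z (Suc i))))" for i
  proof -
    have "int_dist (real (q i) * xi \<mm>) \<le> \<bar>real (q i) * xi \<mm> - numer (z (Suc i))\<bar>"
      unfolding int_dist_def dist_real_def
      using round_diff_minimal[of "real (q i) * xi \<mm>" "numer (z (Suc i))"]
      by simp
    also have "\<dots> = \<bar>real (q i) * (xi \<mm> - approx (z (Suc i)))\<bar>"
      using q0[of i] by (simp add: q approx_def algebra_simps)
    also have "\<dots> = real (q i) * \<bar>approx (z (Suc i)) - xi \<mm>\<bar>"
      by (simp add: abs_mult abs_minus_commute)
    finally have "real (q i) * int_dist (real (q i) * xi \<mm>)
        \<le> real (q i) * (real (q i) * \<bar>approx (z (Suc i)) - xi \<mm>\<bar>)"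
      by (intro mult_left_mono) auto
    also have "\<dots> \<le> 1 / (3 - 1 / denom (z (Suc i)))"
      using near[of i] by (simp add: q power2_eq_square mult.assoc)
    finally show ?thesis by (simp add: g_def)
  qed
  have "lagrange_const (xi \<mm>) = liminf g" by (simp add: lagrange_const_def g_def[abs_def])
  also have "\<dots> \<le> liminf (g \<circ> q)" by (rule liminf_subseq_mono[OF mono])
  also have "\<dots> \<le> liminf (\<lambda>i. ereal (1 / (3 - 1 / denom (z (Suc i)))))"
    by (intro Liminf_mono always_eventually) (use bound in simp)
  also have "\<dots> = ereal (1 / (3 - 0))"
    by (intro lim_imp_Liminf tendsto_intros
        LIMSEQ_Suc[OF inverse_zigzag_fst_tendsto_0[OF z]]) auto
  finally show ?thesis by simp
qed

theorem corollary5p10: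
  fixes \<mm> :: triple
  assumes "\<mm> \<in> Sigma_star"
  shows "lagrange_const (xi \<mm>) = ereal (form_min (G_form \<mm>) / 3)
       \<and> form_min (G_form \<mm>) / 3 = 1 / 3"
  using lagrange_lower[OF assms] lagrange_upper[OF assms] form_min_G_form[OF assms]
  by (simp add: antisym)

end
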